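(* Let $A$ be an $s\times s$ expanding matrix with integer entries and let $\mathcal D\subset\mathbb Z^s$ be a tile digit set with respect to $A$. Then $\mathcal D$ is an integer tile, i.e. there exists $\mathcal L\subset\mathbb Z^s$ such that $\mathcal D\oplus\mathcal L=\mathbb Z^s$.
   Context: A matrix is expanding if all its eigenvalues have modulus $>1$. For a finite set $\mathcal D\subset\mathbb Z^s$, $T(A,\mathcal D)=\{\sum_{k=1}^\infty A^{-k}d_k: d_k\in\mathcal D\}$ is the unique (nonempty) compact set $T\subset\mathbb R^s$ with $AT=T+\mathcal D$. $\mathcal D$ is called a tile digit set with respect to $A$ if $\#\mathcal D=|\det A|$ and $T(A,\mathcal D)$ has nonempty interior (then $T(A,\mathcal D)$ is called a self-affine tile). For sets $X,Y$, the notation $X\oplus Y=\{x+y:x\in X,y\in Y\}$ means that all the sums $x+y$ are distinct. A finite set $\mathcal A\subset\mathbb Z^s$ is an integer tile if $\mathcal A\oplus\mathcal L=\mathbb Z^s$ for some $\mathcal L\subset\mathbb Z^s$. *)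

theory Defs
  imports "HOL-Analysis.Analysis"
begin

definition of_int_vec :: "int ^ 'n \<Rightarrow> 'a::ring_1 ^ 'n" where
  "of_int_vec v = (\<chi> i. of_int (v $ i))"

definition eigenvalue :: "'a::field ^ 'n ^ 'n \<Rightarrow> 'a \<Rightarrow> bool" where
  "eigenvalue M c \<longleftrightarrow> (\<exists>v. v \<noteq> 0 \<and> M *v v = c *s v)"

text \<open>The eigenvalues range over the complex numbers, not only the real ones.\<close>

definition expanding :: "int ^ 'n ^ 'n \<Rightarrow> bool" where
  "expanding A \<longleftrightarrow> (\<forall>c::complex. eigenvalue (map_matrix of_int A) c \<longrightarrow> cmod c > 1)"

text \<open>The set of all sums of \<open>A\<^sup>-\<^sup>k d\<^sub>k\<close> over \<open>k \<ge> 1\<close>, for digit sequences in \<open>D\<close>. Sequences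
  are indexed from 0, so \<open>d k\<close> is the digit \<open>d\<^sub>k\<^sub>+\<^sub>1\<close>. The negative power of \<open>A\<close> is
  the iterated action of the inverse matrix. If \<open>A\<close> is expanding, it is invertible and every such
  series converges; the definition is only meant for that case.\<close>

definition self_affine_set :: "int ^ 'n ^ 'n \<Rightarrow> (int ^ 'n) set \<Rightarrow> (real ^ 'n) set" where
  "self_affine_set A D =
    {x. \<exists>d :: nat \<Rightarrow> int ^ 'n. (\<forall>k. d k \<in> D) \<and>
      (\<lambda>k. (((*v) (matrix_inv (map_matrix of_int A))) ^^ Suc k) (of_int_vec (d k))) sums x}"

definition tile_digit_set :: "int ^ 'n ^ 'n \<Rightarrow> (int ^ 'n) set \<Rightarrow> bool" where
  "tile_digit_set A D \<longleftrightarrow>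
    finite D \<and> int (card D) = \<bar>det A\<bar> \<and> interior (self_affine_set A D) \<noteq> {}"

definition is_direct_sum :: "'a::plus set \<Rightarrow> 'a set \<Rightarrow> 'a set \<Rightarrow> bool" where
  "is_direct_sum X Y Z \<longleftrightarrow>
    {x + y | x y. x \<in> X \<and> y \<in> Y} = Z \<and> inj_on (\<lambda>(x, y). x + y) (X \<times> Y)"

definition integer_tile :: "(int ^ 'n) set \<Rightarrow> bool" where
  "integer_tile D \<longleftrightarrow> finite D \<and> (\<exists>L. is_direct_sum D L UNIV)"

end

theory Submission
  imports Defs "HOL-Computational_Algebra.Fundamental_Theorem_Algebra"
begin

text \<open>Let \<open>K\<close> be the closure of \<open>T(A, D)\<close>. It satisfies \<open>A K = K + D\<close>, so \<open>A\<^sup>k K\<close> is the union of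
  the translates of \<open>K\<close> by the values of the \<open>|det A|\<^sup>k\<close> digit strings of length \<open>k\<close>. Comparing Lebesgue
  measures, translates belonging to different strings overlap in null sets only. Hence for a generic
  point \<open>x\<close> every lattice point \<open>y\<close> with \<open>x + y \<in> A\<^sup>k K\<close> is uniquely a string value plus an element of
  \<open>S = {w. x + w \<in> K}\<close>; splitting off the leading digit writes these \<open>y\<close> uniquely as \<open>d + l\<close> with
  \<open>d \<in> D\<close> and \<open>l\<close> in a fixed set. Since \<open>K\<close> has interior points and \<open>A\<close> is expanding, \<open>A\<^sup>k K\<close> contains
  arbitrarily large balls, so \<open>D\<close> tiles every finite part of the lattice, and compactness of
  the space of subsets of the lattice yields a global complement.\<close>

section \<open>Complements by compactness\<close>

text \<open>Once \<open>d\<close> is chosen, the second summand is forced to be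
  \<open>y - d\<close>, so uniqueness of the pair is uniqueness of the digit. The condition is now
  local: each \<open>y\<close> tests \<open>L\<close> only on the translate
  \<open>y - D\<close>.\<close>

lemma is_direct_sum_UNIV_iff:
  fixes D L :: "'a::ab_group_add set"
  shows "is_direct_sum D L UNIV \<longleftrightarrow> (\<forall>y. \<exists>!d. d \<in> D \<and> y - d \<in> L)"
proof
  assume ds: "is_direct_sum D L UNIV"
  show "\<forall>y. \<exists>!d. d \<in> D \<and> y - d \<in> L"
  proof
    fix y
    from ds have "y \<in> {x + y | x y. x \<in> D \<and> y \<in> L}"
      unfolding is_direct_sum_def by blast
    then obtain d l where dl: "d \<in> D" "l \<in> L" "y = d + l"
      by blast
    have uniq: "d' = d" if "d' \<in> D" "y - d' \<in> L" for d'
    proof -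
      have "inj_on (\<lambda>(x, y). x + y) (D \<times> L)"
        using ds unfolding is_direct_sum_def by blast
      then have "(d', y - d') = (d, l)"
      proof (rule inj_onD)
        show "(case (d', y - d') of (x, y) \<Rightarrow> x + y) = (case (d, l) of (x, y) \<Rightarrow> x + y)"
          by (simp add: dl(3))
      qed (use that dl(1,2) in blast)+
      then show ?thesis by blast
    qed
    show "\<exists>!d. d \<in> D \<and> y - d \<in> L"
    proof (rule ex1I)
      show "d \<in> D \<and> y - d \<in> L" using dl by simp
    qed (rule uniq, simp_all)
  qed
next
  assume uniq: "\<forall>y. \<exists>!d. d \<in> D \<and> y - d \<in> L"
  have "inj_on (\<lambda>(x, y). x + y) (D \<times> L)"
  proof (rule inj_onI, clarsimp)
    fix d l d' l'
    assume *: "d \<in> D" "l \<in> L" "d' \<in> D" "l' \<in> L" "d + l = d' + l'"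
    have "d + l - d \<in> L" using *(2) by (simp only: add_diff_cancel_left')
    moreover have "d + l - d' \<in> L" using *(4) by (simp only: *(5) add_diff_cancel_left')
    ultimately have "d = d'" using uniq * by blast
    then show "d = d' \<and> l = l'" using * by simp
  qed
  moreover have "y \<in> {x + y | x y. x \<in> D \<and> y \<in> L}" for y
  proof -
    obtain d where "d \<in> D" "y - d \<in> L" using uniq by blast
    then show ?thesis by (intro CollectI exI[of _ d] exI[of _ "y - d"]) auto
  qed
  ultimately show "is_direct_sum D L UNIV"
    unfolding is_direct_sum_def by blast
qed

text \<open>Subsets of the group are points of a product of two-point discrete spaces, which is
  compact by Tychonoff. The condition at \<open>y\<close> involves finitely many coordinates, so it
  is closed, and the hypothesis \<open>fin\<close> is the finite intersection property.\<close>

lemma tiling_complement_compactness: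
  fixes D :: "'a::ab_group_add set"
  assumes "finite D"
    and fin: "\<And>F. finite F \<Longrightarrow> \<exists>L. \<forall>y\<in>F. \<exists>!d. d \<in> D \<and> y - d \<in> L"
  shows "\<exists>L. is_direct_sum D L UNIV"
proof -
  let ?X = "product_topology (\<lambda>_::'a. discrete_topology (UNIV::bool set)) UNIV"
  define C where "C y = {p. \<exists>!d. d \<in> D \<and> p (y - d)}" for y
  have top: "topspace ?X = UNIV" by simp
  have cyl: "closedin ?X {p. p z = b}" for z b
  proof -
    have "closedin ?X {p \<in> topspace ?X. p z \<in> {b}}"
      by (rule closedin_continuous_map_preimage[where Y = "discrete_topology UNIV"])
         (auto intro: continuous_map_product_projection)
    then show ?thesis by simp
  qed
  \<comment> \<open>A union over the digit \<open>d\<close> that works at \<open>y\<close>, each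
    piece a finite intersection of cylinders. For \<open>d\<close> in \<open>D\<close> the index set
    \<open>insert d D\<close> is just \<open>D\<close>, but visibly nonempty, as closedness of an
    intersection demands.\<close>
  have "C y = (\<Union>d\<in>D. {p. p (y - d) = True} \<inter> (\<Inter>d'\<in>insert d D. {p. p (y - d') = (d' = d)}))" for y
    by (auto simp: C_def)
  moreover have "closedin ?X (\<Union>d\<in>D. {p. p (y - d) = True} \<inter> (\<Inter>d'\<in>insert d D. {p. p (y - d') = (d' = d)}))" for y
    using \<open>finite D\<close> by (intro closedin_Union finite_imageI) (auto intro!: closedin_Int closedin_Inter cyl simp del: eq_True)
  ultimately have closed: "closedin ?X (C y)" for y
    by simp
  have cs: "compact_space ?X"
    by (simp add: compact_space_product_topology compact_space_discrete_topology)
  have clos: "\<forall>c\<in>range C. closedin ?X c" using closed by blast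
  have fip: "\<forall>\<F>. finite \<F> \<and> \<F> \<subseteq> range C \<longrightarrow> \<Inter>\<F> \<noteq> {}"
  proof (intro allI impI, elim conjE)
    fix \<F> assume "finite \<F>" "\<F> \<subseteq> range C"
    then obtain F where F: "finite F" "\<F> = C ` F"
      by (meson finite_subset_image)
    obtain L where "\<forall>y\<in>F. \<exists>!d. d \<in> D \<and> y - d \<in> L"
      using fin[OF F(1)] by (rule exE)
    then have "(\<lambda>z. z \<in> L) \<in> \<Inter>\<F>" unfolding F(2) C_def by simp
    then show "\<Inter>\<F> \<noteq> {}" by blast
  qed
  have "\<Inter>(range C) \<noteq> {}"
    using cs[unfolded compact_space_fip, THEN spec, THEN mp, OF conjI, OF clos fip] .
  then obtain p where "\<And>y. p \<in> C y" by blast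
  then have "\<forall>y. \<exists>!d. d \<in> D \<and> y - d \<in> {z. p z}"
    by (simp add: C_def)
  then show ?thesis by (auto simp only: is_direct_sum_UNIV_iff)
qed

section \<open>Powers of a matrix with eigenvalues inside the unit disc\<close>

text \<open>The vector \<open>p(M) v\<close>, evaluated by Horner's scheme without forming the
  matrix \<open>p(M)\<close>.\<close>

definition poly_matvec :: "'a::field poly \<Rightarrow> 'a ^ 'n ^ 'n \<Rightarrow> 'a ^ 'n \<Rightarrow> 'a ^ 'n" where
  "poly_matvec p M v = fold_coeffs (\<lambda>a w. a *s v + M *v w) p 0"

lemma poly_matvec_0 [simp]: "poly_matvec 0 M v = 0"
  by (simp add: poly_matvec_def)

lemma poly_matvec_pCons [simp]: "poly_matvec (pCons a p) M v = a *s v + M *v poly_matvec p M v"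
  by (cases "p = 0 \<and> a = 0") (auto simp: poly_matvec_def)

lemma poly_matvec_add: "poly_matvec (p + q) M v = poly_matvec p M v + poly_matvec q M v"
  by (induction p q rule: poly_induct2)
     (simp_all add: matrix_vector_right_distrib vector_sadd_rdistrib algebra_simps)

lemma poly_matvec_smult: "poly_matvec (smult c p) M v = c *s poly_matvec p M v"
  by (induction p) (simp_all add: vector_add_ldistrib vector_smult_assoc vector_scalar_commute)

lemma poly_matvec_diff: "poly_matvec (p - q) M v = poly_matvec p M v - poly_matvec q M v"
proof -
  have "poly_matvec p M v = poly_matvec (p - q) M v + poly_matvec q M v"
    by (simp only: poly_matvec_add[symmetric] diff_add_cancel)
  then show ?thesis by simp
qed

lemma poly_matvec_commute: "poly_matvec p M (M *v v) = M *v poly_matvec p M v"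
  by (induction p) (simp_all add: matrix_vector_right_distrib vector_scalar_commute)

lemma poly_matvec_scale: "poly_matvec p M (c *s v) = c *s poly_matvec p M v"
  by (induction p)
     (simp_all add: vector_add_ldistrib vector_smult_assoc vector_scalar_commute mult.commute)

lemma poly_matvec_vec_diff: "poly_matvec p M (v - w) = poly_matvec p M v - poly_matvec p M w"
  by (induction p) (simp_all add: vector_ssub_ldistrib matrix_vector_mult_diff_distrib)

lemma poly_matvec_monom: "poly_matvec (monom 1 k) M v = ((*v) M ^^ k) v"
  by (induction k) (simp_all add: monom_0 monom_Suc)

lemma poly_matvec_linear_factor:
  "poly_matvec ([:- c, 1:] * q) M v = M *v poly_matvec q M v - c *s poly_matvec q M v"
  by (simp add: poly_matvec_diff poly_matvec_add poly_matvec_smult)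

text \<open>Otherwise the iterates of \<open>v\<close> under \<open>M\<close> would all be linearly
  independent, which the finite dimension forbids.\<close>

lemma exists_annihilating_poly:
  fixes M :: "'a::field ^ 'n ^ 'n"
  shows "\<exists>p. p \<noteq> 0 \<and> poly_matvec p M v = 0"
proof (rule ccontr)
  assume "\<nexists>p. p \<noteq> 0 \<and> poly_matvec p M v = 0"
  then have ann: "p = 0" if "poly_matvec p M v = 0" for p
    using that by blast
  let ?W = "\<lambda>k. (\<lambda>i. ((*v) M ^^ i) v) ` {..<k}"
  have new: "((*v) M ^^ k) v \<notin> vec.span (?W k)" for k
  proof
    \<comment> \<open>Polynomials of degree below \<open>k\<close>; vanishing coefficients express
      this uniformly, including \<open>k = 0\<close>, where only the zero polynomial is
      left.\<close>
    let ?V = "{poly_matvec p M v | p. \<forall>i\<ge>k. coeff p i = 0}"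
    have "vec.subspace ?V"
    proof (rule vec.subspaceI)
      show "0 \<in> ?V" by (intro CollectI exI[of _ 0]) simp
    next
      fix x y assume "x \<in> ?V" "y \<in> ?V"
      then obtain p q where "x = poly_matvec p M v" "\<forall>i\<ge>k. coeff p i = 0"
        "y = poly_matvec q M v" "\<forall>i\<ge>k. coeff q i = 0" by blast
      then show "x + y \<in> ?V"
        by (intro CollectI exI[of _ "p + q"]) (simp add: poly_matvec_add)
    next
      fix c x assume "x \<in> ?V"
      then obtain p where "x = poly_matvec p M v" "\<forall>i\<ge>k. coeff p i = 0" by blast
      then show "c *s x \<in> ?V"
        by (intro CollectI exI[of _ "smult c p"]) (simp add: poly_matvec_smult)
    qed
    moreover have "?W k \<subseteq> ?V"
    proof clarify
      fix i assume "i < k"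
      then show "\<exists>p. ((*v) M ^^ i) v = poly_matvec p M v \<and> (\<forall>i\<ge>k. coeff p i = 0)"
        by (intro exI[of _ "monom 1 i"]) (simp add: poly_matvec_monom)
    qed
    ultimately have "vec.span (?W k) \<subseteq> ?V"
      by (rule vec.span_minimal[rotated])
    moreover assume "((*v) M ^^ k) v \<in> vec.span (?W k)"
    ultimately obtain p where p: "((*v) M ^^ k) v = poly_matvec p M v" "\<forall>i\<ge>k. coeff p i = 0"
      by blast
    \<comment> \<open>This difference annihilates \<open>v\<close>, hence is zero, yet its
      coefficient at \<open>k\<close> is 1.\<close>
    then have "monom 1 k - p = 0"
      by (intro ann) (simp add: poly_matvec_diff poly_matvec_monom)
    then have "coeff (monom 1 k - p) k = 0" by simp
    then show False using p(2) by simp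
  qed
  have "vec.independent (?W k) \<and> card (?W k) = k" for k
  proof (induction k)
    case (Suc k)
    have W: "?W (Suc k) = insert (((*v) M ^^ k) v) (?W k)"
      by (simp add: lessThan_Suc)
    have "((*v) M ^^ k) v \<notin> ?W k"
      using new[of k] by (rule contra_subsetD[OF vec.span_superset])
    with Suc show ?case
      unfolding W using new[of k] by (simp add: vec.independent_insertI)
  qed (simp add: vec.independent_empty)
  then have "k \<le> vec.dim (UNIV :: ('a ^ 'n) set)" for k
    using vec.independent_card_le_dim[OF subset_UNIV] by metis
  from this[of "Suc (vec.dim (UNIV :: ('a ^ 'n) set))"] show False by simp
qed

section \<open>Summability of the orbit of a vector\<close>

lemma norm_vec_smult: "norm (c *s x) = norm c * norm x"
  for c :: "'a::real_normed_div_algebra" and x :: "'a ^ 'n"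
  by (simp add: norm_vec_def norm_mult L2_set_right_distrib)

lemma summable_of_contractive_recurrence:
  fixes a b :: "nat \<Rightarrow> real"
  assumes a: "\<And>k. a k \<ge> 0" and b: "\<And>k. b k \<ge> 0" "summable b" and r: "0 \<le> r" "r < 1"
    and step: "\<And>k. a (Suc k) \<le> r * a k + b k"
  shows "summable a"
proof (rule summableI_nonneg_bounded)
  \<comment> \<open>The solution of \<open>C = a 0 + r * C + suminf b\<close>, so the bound on
    partial sums reproduces itself in the induction.\<close>
  define C where "C = (a 0 + suminf b) / (1 - r)"
  have C: "a 0 + r * C + suminf b = C" using r by (simp add: C_def field_simps)
  have "suminf b \<ge> 0" using b by (simp add: suminf_nonneg)
  then have "C \<ge> 0" using a[of 0] r by (simp add: C_def)
  show "sum a {..<n} \<le> C" for n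
  proof (induction n)
    case (Suc n)
    have "sum a {..<Suc n} = a 0 + (\<Sum>k<n. a (Suc k))"
      by (rule sum.lessThan_Suc_shift)
    also have "(\<Sum>k<n. a (Suc k)) \<le> (\<Sum>k<n. r * a k + b k)"
      by (intro sum_mono step)
    also have "\<dots> = r * sum a {..<n} + sum b {..<n}"
      by (simp add: sum.distrib sum_distrib_left)
    also have "\<dots> \<le> r * C + suminf b"
      using Suc r b by (intro add_mono mult_left_mono sum_le_suminf) auto
    finally show ?case using C by simp
  qed (simp add: \<open>C \<ge> 0\<close>)
qed (rule a)

lemma funpow_matvec_diff:
  "((*v) M ^^ k) (x - y) = ((*v) M ^^ k) x - ((*v) M ^^ k) y" for M :: "'a::ring_1 ^ 'n ^ 'n"
  by (induction k) (simp_all add: matrix_vector_mult_diff_distrib)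

lemma funpow_matvec_scale:
  "((*v) M ^^ k) (c *s x) = c *s ((*v) M ^^ k) x" for M :: "'a::field ^ 'n ^ 'n"
  by (induction k) (simp_all add: vector_scalar_commute)

text \<open>Induction on the degree of a polynomial annihilating \<open>v\<close>, splitting off one
  root \<open>c\<close> at a time. This replaces the Jordan normal form.\<close>

lemma summable_norm_matrix_powers:
  fixes M :: "complex ^ 'n ^ 'n"
  assumes ev: "\<And>c. eigenvalue M c \<Longrightarrow> cmod c < 1"
  shows "summable (\<lambda>k. norm (((*v) M ^^ k) v))"
proof -
  have "summable (\<lambda>k. norm (((*v) M ^^ k) v))"
    if "p \<noteq> 0" "poly_matvec p M v = 0" for p v
    using that
  proof (induction "degree p" arbitrary: p v)
    case 0
    then obtain c where "p = [:c:]" "c \<noteq> 0"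
      by (metis degree_eq_zeroE pCons_0_0)
    then have "v = 0" using 0 by simp
    moreover have "((*v) M ^^ k) 0 = 0" for k by (induction k) auto
    ultimately show ?case by simp
  next
    case (Suc n)
    obtain c where "poly p c = 0"
      using fundamental_theorem_of_algebra[of p] Suc.hyps(2) by (auto simp: constant_degree)
    then obtain q where p: "p = [:- c, 1:] * q"
      by (auto simp: poly_eq_0_iff_dvd dvd_def)
    then have "q \<noteq> 0" using Suc.prems by auto
    have "degree p = degree [:- c, 1:] + degree q"
      unfolding p using \<open>q \<noteq> 0\<close> by (intro degree_mult_eq) auto
    then have n: "n = degree q" using Suc.hyps(2) by simp
    have Mq: "M *v poly_matvec q M v = c *s poly_matvec q M v"
      using Suc.prems(2) unfolding p poly_matvec_linear_factor by simp
    show ?case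
    proof (cases "eigenvalue M c")
      case False
      then have "poly_matvec q M v = 0" using Mq by (auto simp: eigenvalue_def)
      then show ?thesis using Suc.hyps(1)[OF n \<open>q \<noteq> 0\<close>] by blast
    next
      case True
      \<comment> \<open>The cofactor \<open>q\<close> annihilates \<open>w\<close>, so the induction
        hypothesis applies to \<open>w\<close>. The orbit of \<open>v\<close> then satisfies a
        recurrence with ratio \<open>cmod c\<close> below 1 and a summable error, the orbit of
        \<open>w\<close>.\<close>
      define w where "w = M *v v - c *s v"
      have "poly_matvec q M w = 0"
        using Mq by (simp add: w_def poly_matvec_vec_diff poly_matvec_scale poly_matvec_commute)
      then have "summable (\<lambda>k. norm (((*v) M ^^ k) w))"
        using Suc.hyps(1)[OF n \<open>q \<noteq> 0\<close>] by blast
      moreover have "norm (((*v) M ^^ Suc k) v) \<le> cmod c * norm (((*v) M ^^ k) v) + norm (((*v) M ^^ k) w)" for k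
      proof -
        have "((*v) M ^^ Suc k) v = c *s ((*v) M ^^ k) v + ((*v) M ^^ k) w"
          by (simp add: w_def funpow_matvec_diff funpow_matvec_scale funpow_swap1)
        then show ?thesis
          using norm_triangle_ineq by (metis norm_vec_smult)
      qed
      ultimately show ?thesis
        by (rule summable_of_contractive_recurrence[OF norm_ge_zero norm_ge_zero _ norm_ge_zero ev[OF True]])
    qed
  qed
  then show ?thesis using exists_annihilating_poly by blast
qed

section \<open>The self-affine set of an expanding matrix\<close>

lemma of_int_vec_add: "of_int_vec (x + y) = of_int_vec x + of_int_vec y"
  and of_int_vec_diff: "of_int_vec (x - y) = of_int_vec x - of_int_vec y"
  and of_int_vec_0: "of_int_vec 0 = 0"
  by (simp_all add: of_int_vec_def vec_eq_iff)

lemma of_int_vec_matvec: "of_int_vec (A *v x) = map_matrix of_int A *v of_int_vec x"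
  by (simp add: of_int_vec_def vec_eq_iff matrix_vector_mult_def)

lemma det_map_matrix_of_int: "det (map_matrix of_int A :: 'a::comm_ring_1 ^ 'n ^ 'n) = of_int (det A)"
  by (simp add: det_def)

text \<open>A singular matrix has the eigenvalue 0, whose modulus is not above 1.\<close>

lemma expanding_det_nonzero:
  assumes "expanding A"
  shows "det A \<noteq> 0"
proof
  assume "det A = 0"
  then have "\<not> invertible (map_matrix of_int A :: complex ^ 'a ^ 'a)"
    by (simp add: invertible_det_nz det_map_matrix_of_int)
  then obtain v :: "complex ^ 'a" where "v \<noteq> 0" "map_matrix of_int A *v v = 0"
    unfolding invertible_left_inverse matrix_left_invertible_ker by blast
  then have "eigenvalue (map_matrix of_int A :: complex ^ 'a ^ 'a) 0"
    by (auto simp: eigenvalue_def)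
  then show False using assms by (force simp: expanding_def)
qed

lemma expanding_matrix_inv:
  fixes A :: "int ^ 'n ^ 'n"
  assumes "expanding A"
  shows "map_matrix of_int A ** matrix_inv (map_matrix of_int A) = (mat 1 :: real ^ 'n ^ 'n)"
    and "matrix_inv (map_matrix of_int A) ** map_matrix of_int A = (mat 1 :: real ^ 'n ^ 'n)"
proof -
  have "invertible (map_matrix of_int A :: real ^ 'n ^ 'n)"
    using expanding_det_nonzero[OF assms] by (simp add: invertible_det_nz det_map_matrix_of_int)
  then show "map_matrix of_int A ** matrix_inv (map_matrix of_int A) = (mat 1 :: real ^ 'n ^ 'n)"
    "matrix_inv (map_matrix of_int A) ** map_matrix of_int A = (mat 1 :: real ^ 'n ^ 'n)"
    unfolding invertible_def matrix_inv_def by (metis (mono_tags, lifting) someI_ex)+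
qed

text \<open>Eigenvalues of the inverse are reciprocals of eigenvalues of \<open>A\<close>, hence lie
  inside the unit disc. As they may be non-real, the real problem is moved to complex
  vectors.\<close>

lemma expanding_summable_inverse_powers:
  fixes A :: "int ^ 'n ^ 'n" and v :: "real ^ 'n"
  assumes "expanding A"
  shows "summable (\<lambda>k. norm (((*v) (matrix_inv (map_matrix of_int A)) ^^ k) v))"
proof -
  let ?B = "matrix_inv (map_matrix of_int A) :: real ^ 'n ^ 'n"
  let ?M = "map_matrix complex_of_real ?B"
  let ?A = "map_matrix of_int A :: complex ^ 'n ^ 'n"
  \<comment> \<open>Complexification preserves norms and intertwines \<open>?B\<close> with
    \<open>?M\<close>.\<close>
  define cv where "cv x = (\<chi> i. complex_of_real (x $ i))" for x :: "real ^ 'n"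
  have "?M *v cv x = cv (?B *v x)" for x
    by (simp add: cv_def vec_eq_iff matrix_vector_mult_def)
  then have pow: "((*v) ?M ^^ k) (cv v) = cv (((*v) ?B ^^ k) v)" for k
    by (induction k) simp_all
  have norm_cv: "norm (cv x) = norm x" for x
    by (simp add: cv_def norm_vec_def)
  have "?A ** ?M = map_matrix complex_of_real (map_matrix of_int A ** ?B)"
    by (simp add: vec_eq_iff matrix_matrix_mult_def)
  also have "\<dots> = mat 1"
    by (simp add: expanding_matrix_inv[OF assms] vec_eq_iff mat_def)
  finally have AM: "?A ** ?M = mat 1" .
  have ev_less_1: "cmod c < 1" if ev: "eigenvalue ?M c" for c
  proof -
    obtain w where w: "w \<noteq> 0" "?M *v w = c *s w"
      using ev unfolding eigenvalue_def by blast
    have "w = ?A *v (?M *v w)"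
      by (simp add: matrix_vector_mul_assoc AM)
    then have w_eq: "w = c *s (?A *v w)"
      by (simp add: w(2) vector_scalar_commute)
    then have "c \<noteq> 0" using w(1) by auto
    have "inverse c *s w = inverse c *s (c *s (?A *v w))"
      using w_eq by simp
    then have "?A *v w = inverse c *s w"
      using \<open>c \<noteq> 0\<close> by (simp add: vector_smult_assoc)
    then have "eigenvalue ?A (inverse c)"
      using w(1) by (auto simp: eigenvalue_def)
    then have "cmod (inverse c) > 1"
      using assms by (simp add: expanding_def)
    then show ?thesis
      using \<open>c \<noteq> 0\<close> by (simp add: norm_inverse one_less_inverse_iff)
  qed
  have "summable (\<lambda>k. norm (((*v) ?M ^^ k) (cv v)))"
    using ev_less_1 by (rule summable_norm_matrix_powers)
  then show ?thesis
    by (simp only: pow norm_cv)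
qed

text \<open>Multiplication by \<open>A\<close> shifts the expansion by one place: the first digit
  becomes an integer translation and the remaining digits form another expansion.\<close>

lemma self_affine_set_image:
  fixes A :: "int ^ 'n ^ 'n"
  assumes "expanding A"
  shows "(*v) (map_matrix of_int A) ` self_affine_set A D =
    (\<Union>d\<in>D. (+) (of_int_vec d) ` self_affine_set A D)"
proof -
  let ?A = "map_matrix of_int A :: real ^ 'n ^ 'n"
  let ?B = "matrix_inv ?A"
  have AB: "?A *v (?B *v x) = x" for x
    by (simp add: matrix_vector_mul_assoc expanding_matrix_inv[OF assms])
  have blA: "bounded_linear ((*v) ?A)" and blB: "bounded_linear ((*v) ?B)"
    by (rule matrix_vector_mul_bounded_linear)+
  show ?thesis
  proof (intro equalityI subsetI)
    fix y assume "y \<in> (*v) ?A ` self_affine_set A D"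
    then obtain x d where y: "y = ?A *v x" and d: "\<And>k. d k \<in> D"
      and x: "(\<lambda>k. ((*v) ?B ^^ Suc k) (of_int_vec (d k))) sums x"
      by (auto simp: self_affine_set_def)
    \<comment> \<open>The exponent drops from \<open>Suc k\<close> to \<open>k\<close>, so the term
      at \<open>k = 0\<close> is the digit \<open>d 0\<close> itself.\<close>
    have "(\<lambda>k. ((*v) ?B ^^ k) (of_int_vec (d k))) sums y"
      using bounded_linear.sums[OF blA x] by (simp add: y AB)
    then have "(\<lambda>k. ((*v) ?B ^^ Suc k) (of_int_vec (d (Suc k)))) sums (y - of_int_vec (d 0))"
      by (subst sums_Suc_iff) simp
    then have "y - of_int_vec (d 0) \<in> self_affine_set A D"
      unfolding self_affine_set_def using d by (intro CollectI exI[of _ "\<lambda>k. d (Suc k)"]) simp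
    then have "y \<in> (+) (of_int_vec (d 0)) ` self_affine_set A D"
      by (rule rev_image_eqI) simp
    then show "y \<in> (\<Union>d\<in>D. (+) (of_int_vec d) ` self_affine_set A D)"
      using d by blast
  next
    fix y assume "y \<in> (\<Union>d\<in>D. (+) (of_int_vec d) ` self_affine_set A D)"
    then obtain d0 x d where y: "y = of_int_vec d0 + x" and "d0 \<in> D" and d: "\<And>k. d k \<in> D"
      and x: "(\<lambda>k. ((*v) ?B ^^ Suc k) (of_int_vec (d k))) sums x"
      by (auto simp: self_affine_set_def)
    \<comment> \<open>Prepends \<open>d0\<close> to the digit sequence of \<open>x\<close>.\<close>
    define e where "e = case_nat d0 d"
    have e: "e k \<in> D" for k
      using d \<open>d0 \<in> D\<close> by (simp add: e_def split: nat.split)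
    have "(\<lambda>k. ((*v) ?B ^^ Suc k) (of_int_vec (e (Suc k)))) sums x"
      using x by (simp add: e_def)
    then have "(\<lambda>k. ((*v) ?B ^^ k) (of_int_vec (e k))) sums y"
      by (subst (asm) sums_Suc_iff) (simp add: e_def y add.commute)
    then have "(\<lambda>k. ((*v) ?B ^^ Suc k) (of_int_vec (e k))) sums (?B *v y)"
      using bounded_linear.sums[OF blB] by simp
    then have "?B *v y \<in> self_affine_set A D"
      unfolding self_affine_set_def using e by blast
    then show "y \<in> (*v) ?A ` self_affine_set A D"
      by (rule rev_image_eqI) (simp add: AB)
  qed
qed

text \<open>Summing over all digits in each term gives one convergent majorant for every digit
  sequence.\<close>

lemma bounded_self_affine_set:
  fixes A :: "int ^ 'n ^ 'n"
  assumes "expanding A" "finite D"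
  shows "bounded (self_affine_set A D)"
proof -
  let ?B = "matrix_inv (map_matrix of_int A) :: real ^ 'n ^ 'n"
  let ?g = "\<lambda>k. \<Sum>d\<in>D. norm (((*v) ?B ^^ Suc k) (of_int_vec d))"
  have "summable ?g"
    by (intro summable_sum summable_Suc_iff[THEN iffD2] expanding_summable_inverse_powers[OF assms(1)])
  have "norm x \<le> suminf ?g" if x_in: "x \<in> self_affine_set A D" for x
  proof -
    obtain d where d: "\<And>k. d k \<in> D"
      and x: "(\<lambda>k. ((*v) ?B ^^ Suc k) (of_int_vec (d k))) sums x"
      using x_in unfolding self_affine_set_def by blast
    have "norm (((*v) ?B ^^ Suc k) (of_int_vec (d k))) \<le> ?g k" for k
      using \<open>finite D\<close> d by (intro member_le_sum) auto
    then have "norm (\<Sum>k. ((*v) ?B ^^ Suc k) (of_int_vec (d k))) \<le> suminf ?g"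
      using \<open>summable ?g\<close> by (rule norm_suminf_le)
    then show ?thesis using x by (simp only: sums_unique[OF x, symmetric])
  qed
  then show ?thesis by (auto simp: bounded_iff)
qed

section \<open>Lebesgue measure\<close>

text \<open>The library version \<open>measure_linear_image\<close> needs a well-ordered index type: it computes the
  determinant of a shear as that of a triangular matrix. A row operation does without the order.\<close>

lemma
  fixes f :: "real ^ 'n \<Rightarrow> real ^ 'n"
  assumes "linear f" "S \<in> lmeasurable"
  shows measurable_linear_image_cart: "f ` S \<in> lmeasurable"
    and measure_linear_image_cart:
      "measure lebesgue (f ` S) = \<bar>det (matrix f)\<bar> * measure lebesgue S"
proof -
  define P where "P g \<longleftrightarrow> (\<forall>S\<in>lmeasurable. g ` S \<in> lmeasurable \<and>
    measure lebesgue (g ` S) = \<bar>det (matrix g)\<bar> * measure lebesgue S)"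
    for g :: "real ^ 'n \<Rightarrow> real ^ 'n"
  \<comment> \<open>For determinant of modulus 1, it is enough to test nonempty boxes.\<close>
  have boxes: "P g" if "linear g" "\<bar>det (matrix g)\<bar> = 1"
    and "\<And>a b. cbox a b \<noteq> {} \<Longrightarrow> measure lebesgue (g ` cbox a b) = measure lebesgue (cbox a b)" for g
  proof -
    have "measure lebesgue (g ` cbox a b) = 1 * measure lebesgue (cbox a b)" for a b
      using that(3) by (cases "cbox a b = {}") simp_all
    from measure_linear_sufficient[OF \<open>linear g\<close> _ this] show ?thesis
      unfolding P_def that(2) by metis
  qed
  have "P f"
  proof (rule induct_linear_elementary[OF \<open>linear f\<close>])
    fix f g :: "real ^ 'n \<Rightarrow> real ^ 'n"
    assume fg: "linear f" "linear g" "P f" "P g"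
    have "f ` g ` S \<in> lmeasurable \<and>
        measure lebesgue (f ` g ` S) = \<bar>det (matrix (f \<circ> g))\<bar> * measure lebesgue S"
      if "S \<in> lmeasurable" for S
      using that fg by (simp add: P_def matrix_compose[OF fg(2,1)] det_mul abs_mult)
    then show "P (f \<circ> g)"
      by (simp only: P_def image_comp) blast
  next
    fix g :: "real ^ 'n \<Rightarrow> real ^ 'n" and i
    assume g: "linear g" "\<And>x. g x $ i = 0"
    \<comment> \<open>A vanishing coordinate makes \<open>g\<close> singular, so both sides of the
      measure formula are 0.\<close>
    have "\<not> surj g"
      using g(2) by (metis one_neq_zero surjE vec_component)
    then have "\<not> inj g"
      using \<open>linear g\<close> linear_injective_imp_surjective by blast
    then have "det (matrix g) = 0"
      using \<open>linear g\<close> det_nz_iff_inj by blast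
    moreover have "negligible (g ` S)" for S
      using \<open>linear g\<close> \<open>\<not> inj g\<close> by (rule negligible_linear_singular_image)
    ultimately show "P g"
      by (simp add: P_def negligible_imp_measurable negligible_imp_measure0)
  next
    fix c :: "'n \<Rightarrow> real"
    show "P (\<lambda>x. \<chi> i. c i * x $ i)"
      by (simp add: P_def measurable_stretch measure_stretch matrix_def axis_def det_diagonal)
  next
    fix m n :: 'n
    assume "m \<noteq> n"
    let ?\<tau> = "Transposition.transpose m n"
    let ?g = "\<lambda>x::real ^ 'n. \<chi> i. x $ ?\<tau> i"
    have "linear ?g" by (rule linearI) (simp_all add: vec_eq_iff)
    moreover have "matrix ?g = (\<chi> i. mat 1 $ ?\<tau> i)"
      by (auto simp: matrix_def mat_def axis_def vec_eq_iff)
    then have "\<bar>det (matrix ?g)\<bar> = 1"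
      by (simp add: det_permute_rows permutes_swap_id sign_swap_id abs_mult)
    moreover have "measure lebesgue (?g ` cbox a b) = measure lebesgue (cbox a b)"
      if "cbox a b \<noteq> {}" for a b
    proof -
      have "?g ` cbox a b = cbox (?g a) (?g b)"
      proof
        show "cbox (?g a) (?g b) \<subseteq> ?g ` cbox a b"
        proof
          fix y assume "y \<in> cbox (?g a) (?g b)"
          then have "?g a $ ?\<tau> i \<le> y $ ?\<tau> i \<and> y $ ?\<tau> i \<le> ?g b $ ?\<tau> i" for i
            unfolding mem_box_cart by blast
          then have "?g y \<in> cbox a b" by (simp add: mem_box_cart)
          moreover have "y = ?g (?g y)" by (simp add: vec_eq_iff)
          ultimately show "y \<in> ?g ` cbox a b" by blast
        qed
      qed (auto simp: mem_box_cart)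
      moreover from this that have "cbox (?g a) (?g b) \<noteq> {}" by blast
      moreover have "(\<Prod>i\<in>UNIV. b $ ?\<tau> i - a $ ?\<tau> i) = (\<Prod>i\<in>UNIV. b $ i - a $ i)"
        using prod.permute[OF permutes_swap_id[of m UNIV n], of "\<lambda>i. b $ i - a $ i"]
        by (simp add: o_def)
      ultimately show ?thesis
        using that content_cbox_cart[OF that] content_cbox_cart[of "?g a" "?g b"] by simp
    qed
    ultimately show "P ?g" by (rule boxes)
  next
    fix m n :: 'n
    assume "m \<noteq> n"
    let ?g = "\<lambda>x::real ^ 'n. \<chi> i. if i = m then x $ m + x $ n else x $ i"
    have lin: "linear ?g"
      by (rule linearI) (auto simp: algebra_simps vec_eq_iff)
    moreover have "matrix ?g = (\<chi> k. if k = m then row m (mat 1) + 1 *s row n (mat 1) else row k (mat 1))"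
      by (auto simp: matrix_def mat_def axis_def row_def vec_eq_iff)
    then have "\<bar>det (matrix ?g)\<bar> = 1"
      using det_row_operation[OF \<open>m \<noteq> n\<close>, of "mat 1 :: real ^ 'n ^ 'n" 1] by simp
    moreover have "measure lebesgue (?g ` cbox a b) = measure lebesgue (cbox a b)"
      if "cbox a b \<noteq> {}" for a b
    proof -
      \<comment> \<open>Translation by \<open>v\<close> brings the lower bound of coordinate
        \<open>n\<close> to 0, meeting the nonnegativity condition of
        \<open>measure_shear_interval\<close>.\<close>
      define v where "v = (\<chi> i. if i = n then a $ n else 0)"
      have ab: "cbox a b = (+) v ` cbox (a - v) (b - v)"
        by (simp add: cbox_translation[symmetric])
      have "?g ` cbox a b = (+) (?g v) ` ?g ` cbox (a - v) (b - v)"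
        unfolding ab image_image by (intro image_cong refl linear_add[OF lin])
      then have "measure lebesgue (?g ` cbox a b) = measure lebesgue (?g ` cbox (a - v) (b - v))"
        by (simp only: measure_translation)
      also have "\<dots> = measure lebesgue (cbox (a - v) (b - v))"
        using that \<open>m \<noteq> n\<close> by (intro measure_shear_interval) (simp_all add: ab v_def)
      also have "\<dots> = measure lebesgue (cbox a b)"
        by (simp only: ab measure_translation)
      finally show ?thesis .
    qed
    ultimately show "P ?g" by (rule boxes)
  qed
  then show "f ` S \<in> lmeasurable" "measure lebesgue (f ` S) = \<bar>det (matrix f)\<bar> * measure lebesgue S"
    using \<open>S \<in> lmeasurable\<close> by (simp_all add: P_def)
qed

text \<open>Equality in subadditivity leaves no room for overlap: \<open>S j\<close> meets the union
  of all the other sets in measure zero.\<close>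

lemma negligible_Int_of_measure_Union_eq_sum:
  assumes "finite I" and meas: "\<And>i. i \<in> I \<Longrightarrow> S i \<in> lmeasurable"
    and sum: "measure lebesgue (\<Union>i\<in>I. S i) = (\<Sum>i\<in>I. measure lebesgue (S i))"
    and ij: "i \<in> I" "j \<in> I" "i \<noteq> j"
  shows "negligible (S i \<inter> S j)"
proof -
  let ?U = "\<Union>k\<in>I - {j}. S k"
  have U: "?U \<in> lmeasurable"
    using \<open>finite I\<close> meas by (intro fmeasurable.finite_UN) auto
  have Sj: "S j \<in> lmeasurable" using meas ij by blast
  have "(\<Union>k\<in>I. S k) = ?U \<union> S j" using ij by blast
  then have "measure lebesgue (\<Union>k\<in>I. S k) =
      measure lebesgue ?U + measure lebesgue (S j) - measure lebesgue (?U \<inter> S j)"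
    using measure_Un3[OF U Sj] by simp
  moreover have "measure lebesgue ?U \<le> (\<Sum>k\<in>I - {j}. measure lebesgue (S k))"
    using \<open>finite I\<close> meas by (intro measure_UNION_le) (auto intro: fmeasurableD)
  moreover have "(\<Sum>k\<in>I. measure lebesgue (S k)) =
      measure lebesgue (S j) + (\<Sum>k\<in>I - {j}. measure lebesgue (S k))"
    using \<open>finite I\<close> ij(2) by (rule sum.remove)
  ultimately have "measure lebesgue (?U \<inter> S j) = 0"
    using sum measure_nonneg[of lebesgue "?U \<inter> S j"] by linarith
  then have "negligible (?U \<inter> S j)"
    using U Sj by (simp add: negligible_iff_measure fmeasurable.Int)
  then show ?thesis
    by (rule negligible_subset) (use ij in blast)
qed

section \<open>Digit strings and lattice tilings\<close>

text \<open>Base-\<open>A\<close> expansion with the units digit at the head of the list.\<close>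

primrec digits_value :: "int ^ 'n ^ 'n \<Rightarrow> (int ^ 'n) list \<Rightarrow> int ^ 'n" where
  "digits_value A [] = 0"
| "digits_value A (d # ds) = d + A *v digits_value A ds"

text \<open>Strings are kept rather than their values, so two strings with equal value still count
  twice; the number of strings is then \<open>card D ^ k\<close> with no injectivity to
  prove.\<close>

definition digit_lists :: "'a set \<Rightarrow> nat \<Rightarrow> 'a list set" where
  "digit_lists D k = {ds. set ds \<subseteq> D \<and> length ds = k}"

lemma finite_digit_lists: "finite D \<Longrightarrow> finite (digit_lists D k)"
  unfolding digit_lists_def by (rule finite_lists_length_eq)

lemma card_digit_lists: "finite D \<Longrightarrow> card (digit_lists D k) = card D ^ k"
  unfolding digit_lists_def by (rule card_lists_length_eq)

lemma digit_lists_0: "digit_lists D 0 = {[]}"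
  by (auto simp: digit_lists_def)

lemma digit_lists_Suc: "digit_lists D (Suc k) = (\<Union>ds\<in>digit_lists D k. \<Union>d\<in>D. {d # ds})"
  by (auto simp: digit_lists_def length_Suc_conv)

lemma funpow_left_inverse:
  fixes f g :: "'a \<Rightarrow> 'a"
  assumes "\<And>x. f (g x) = x"
  shows "(f ^^ k) ((g ^^ k) x) = x"
proof (induction k)
  case (Suc k)
  then show ?case
    \<comment> \<open>One \<open>f\<close> is split off on the inside and one \<open>g\<close> on
      the outside, so that they meet and cancel.\<close>
    by (simp only: funpow_Suc_right[where f = f] funpow.simps(2)[where f = g] comp_apply assms)
qed simp

text \<open>The properties of \<open>K\<close> on which the tiling argument rests: compactness makes
  its measure finite, the interior supplies large balls, and the set equation supplies the
  digits.\<close>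

locale self_affine_region =
  fixes A :: "int ^ 'n ^ 'n" and D :: "(int ^ 'n) set" and K :: "(real ^ 'n) set"
  assumes expanding: "expanding A"
    and finite_D: "finite D"
    and card_D: "int (card D) = \<bar>det A\<bar>"
    and compact_K: "compact K"
    and interior_K: "interior K \<noteq> {}"
    and image_K: "(*v) (map_matrix of_int A) ` K = (\<Union>d\<in>D. (+) (of_int_vec d) ` K)"
begin

abbreviation f :: "real ^ 'n \<Rightarrow> real ^ 'n" where
  "f \<equiv> (*v) (map_matrix of_int A)"

abbreviation g :: "real ^ 'n \<Rightarrow> real ^ 'n" where
  "g \<equiv> (*v) (matrix_inv (map_matrix of_int A))"

abbreviation translate :: "(int ^ 'n) list \<Rightarrow> (real ^ 'n) set" where
  "translate ds \<equiv> (+) (of_int_vec (digits_value A ds)) ` K"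

text \<open>Each further application of \<open>f\<close> multiplies the old string values by
  \<open>A\<close> and, by \<open>image_K\<close>, adds a new units digit.\<close>

lemma funpow_image_K: "(f ^^ k) ` K = (\<Union>ds\<in>digit_lists D k. translate ds)"
proof (induction k)
  case 0
  then show ?case by (simp add: digit_lists_0 of_int_vec_0)
next
  case (Suc k)
  have translate_Cons: "(+) (of_int_vec (A *v v)) ` (+) (of_int_vec d) ` K = (+) (of_int_vec (d + A *v v)) ` K"
    for d v by (simp add: image_image of_int_vec_add ac_simps)
  have "(f ^^ Suc k) ` K = f ` (f ^^ k) ` K"
    by (simp only: funpow.simps(2) image_comp)
  also have "\<dots> = (\<Union>ds\<in>digit_lists D k. (+) (of_int_vec (A *v digits_value A ds)) ` f ` K)"
    by (simp add: Suc image_UN image_image matrix_vector_right_distrib of_int_vec_matvec)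
  also have "\<dots> = (\<Union>ds\<in>digit_lists D k. \<Union>d\<in>D. translate (d # ds))"
    by (simp only: image_K image_UN translate_Cons digits_value.simps)
  also have "\<dots> = (\<Union>ds\<in>digit_lists D (Suc k). translate ds)"
    by (simp add: digit_lists_Suc)
  finally show ?case .
qed

section \<open>Measure-disjointness of the translates\<close>

lemma lmeasurable_K: "K \<in> lmeasurable"
  using compact_K by (rule lmeasurable_compact)

lemma lmeasurable_translate: "translate ds \<in> lmeasurable"
  using lmeasurable_K by (rule measurable_translation)

lemma measure_funpow_image_K:
  "(f ^^ k) ` K \<in> lmeasurable \<and> measure lebesgue ((f ^^ k) ` K) = real (card D) ^ k * measure lebesgue K"
proof (induction k)
  case 0
  then show ?case by (simp add: lmeasurable_K)
next
  case (Suc k)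
  have "\<bar>det (map_matrix of_int A :: real ^ 'n ^ 'n)\<bar> = real_of_int (int (card D))"
    by (simp only: det_map_matrix_of_int card_D of_int_abs)
  moreover have "(f ^^ Suc k) ` K = f ` (f ^^ k) ` K"
    by (simp only: funpow.simps(2) image_comp)
  moreover from Suc have S: "(f ^^ k) ` K \<in> lmeasurable" by (rule conjunct1)
  ultimately show ?case
    using conjunct2[OF Suc] measurable_linear_image_cart[OF matrix_vector_mul_linear S]
      measure_linear_image_cart[OF matrix_vector_mul_linear S]
    by (simp only: matrix_of_matrix_vector_mul of_int_of_nat_eq power_Suc mult.assoc simp_thms)
qed

text \<open>Scaling by the determinant gives the union measure \<open>card D ^ k\<close> times that
  of \<open>K\<close>, which is also the sum over all strings.\<close>

lemma negligible_translates_Int: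
  assumes "ds \<in> digit_lists D k" "es \<in> digit_lists D k" "ds \<noteq> es"
  shows "negligible (translate ds \<inter> translate es)"
proof (rule negligible_Int_of_measure_Union_eq_sum[OF finite_digit_lists[OF finite_D] _ _ assms])
  show "measure lebesgue (\<Union>ds\<in>digit_lists D k. translate ds) =
      (\<Sum>ds\<in>digit_lists D k. measure lebesgue (translate ds))"
    using measure_funpow_image_K[of k]
    by (simp add: funpow_image_K[symmetric] measure_translation card_digit_lists[OF finite_D])
qed (rule lmeasurable_translate)

section \<open>Contraction by the inverse and large balls\<close>

lemma f_g: "f (g x) = x" and g_f: "g (f x) = x"
  by (simp_all add: matrix_vector_mul_assoc expanding_matrix_inv[OF expanding])

lemma funpow_f_g: "(f ^^ k) ((g ^^ k) x) = x" and funpow_g_f: "(g ^^ k) ((f ^^ k) x) = x"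
by (rule funpow_left_inverse, rule f_g) (rule funpow_left_inverse, rule g_f)

lemma linear_funpow_g: "linear (g ^^ k)"
  by (induction k) (simp_all add: linear_compose[unfolded o_def] linear_id[unfolded id_def] o_def)

text \<open>A linear map is bounded by the sum of its norms on the basis vectors, and that sum tends
  to 0. The exponent is a successor because a digit is split off later.\<close>

lemma funpow_g_uniformly_small:
  assumes "e > 0"
  shows "\<exists>k. \<forall>x. norm ((g ^^ Suc k) x) \<le> e * norm x"
proof -
  let ?s = "\<lambda>k. \<Sum>b\<in>Basis. norm ((g ^^ k) b)"
  have "?s \<longlonglongrightarrow> (\<Sum>b\<in>(Basis :: (real ^ 'n) set). 0)"
    by (intro tendsto_sum summable_LIMSEQ_zero expanding_summable_inverse_powers expanding)
  then have "?s \<longlonglongrightarrow> 0" by simp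
  then have "\<forall>\<^sub>F k in sequentially. ?s k < e"
    using \<open>e > 0\<close> by (rule order_tendstoD)
  then obtain k where k: "?s (Suc k) < e"
    unfolding eventually_sequentially by (meson le_SucI order_refl)
  have "norm ((g ^^ Suc k) x) \<le> e * norm x" for x
  proof -
    have "(g ^^ Suc k) x = (g ^^ Suc k) (\<Sum>b\<in>Basis. (x \<bullet> b) *\<^sub>R b)"
      by (simp only: euclidean_representation)
    also have "\<dots> = (\<Sum>b\<in>Basis. (x \<bullet> b) *\<^sub>R (g ^^ Suc k) b)"
      by (simp only: linear_sum[OF linear_funpow_g] linear_scale[OF linear_funpow_g])
    also have "norm \<dots> \<le> (\<Sum>b\<in>Basis. norm x * norm ((g ^^ Suc k) b))"
    proof (rule sum_norm_le)
      fix b :: "real ^ 'n" assume "b \<in> Basis"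
      show "norm ((x \<bullet> b) *\<^sub>R (g ^^ Suc k) b) \<le> norm x * norm ((g ^^ Suc k) b)"
        using Basis_le_norm[OF \<open>b \<in> Basis\<close>, of x] by (simp only: norm_scaleR) (intro mult_right_mono norm_ge_zero)
    qed
    also have "\<dots> = norm x * ?s (Suc k)"
      by (simp only: sum_distrib_left)
    also have "\<dots> \<le> norm x * e"
      using k by (intro mult_left_mono norm_ge_zero) simp
    finally show ?thesis by (simp only: mult.commute)
  qed
  then show ?thesis by blast
qed

lemma funpow_image_K_contains_ball: "\<exists>k z. ball z R \<subseteq> (f ^^ Suc k) ` K"
proof -
  obtain z0 where "z0 \<in> interior K"
    using interior_K by blast
  then obtain r where r: "r > 0" "ball z0 r \<subseteq> K"
    unfolding mem_interior by blast
  \<comment> \<open>With this contraction factor the ball of radius \<open>R\<close> is pulled back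
    into \<open>ball z0 r\<close>. The denominator is positive and exceeds \<open>R\<close> for
    every real \<open>R\<close>.\<close>
  define e where "e = r / (\<bar>R\<bar> + 1)"
  have "e > 0" using r by (simp add: e_def)
  then obtain k where k: "\<And>x. norm ((g ^^ Suc k) x) \<le> e * norm x"
    using funpow_g_uniformly_small by blast
  have "y \<in> (f ^^ Suc k) ` K" if "y \<in> ball ((f ^^ Suc k) z0) R" for y
  proof -
    have "(g ^^ Suc k) ((f ^^ Suc k) z0 - y) = z0 - (g ^^ Suc k) y"
      by (simp only: linear_diff[OF linear_funpow_g] funpow_g_f)
    then have "dist z0 ((g ^^ Suc k) y) \<le> e * dist ((f ^^ Suc k) z0) y"
      using k[of "(f ^^ Suc k) z0 - y"] by (simp only: dist_norm)
    also have "\<dots> < e * (\<bar>R\<bar> + 1)"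
      using that \<open>e > 0\<close> by (intro mult_strict_left_mono) auto
    also have "\<dots> = r" by (simp add: e_def)
    finally have "(g ^^ Suc k) y \<in> K"
      using r(2) by (simp only: mem_ball subset_iff)
    then show ?thesis
      by (rule rev_image_eqI) (simp only: funpow_f_g)
  qed
  then show ?thesis by blast
qed

text \<open>The bad points form a countable union of lattice translates of null overlaps, which
  cannot fill the space.\<close>

lemma exists_generic_point:
  "\<exists>x. \<forall>w. \<forall>ds\<in>digit_lists D k. \<forall>es\<in>digit_lists D k.
     x + of_int_vec w \<in> translate ds \<inter> translate es \<longrightarrow> ds = es"
proof -
  let ?I = "{(ds, es). ds \<in> digit_lists D k \<and> es \<in> digit_lists D k \<and> ds \<noteq> es}"
  let ?N = "\<lambda>(w, ds, es). (+) (- of_int_vec w) ` (translate ds \<inter> translate es)"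
  have "?I \<subseteq> digit_lists D k \<times> digit_lists D k" by blast
  then have "finite ?I"
    using finite_digit_lists[OF finite_D] finite_subset by blast
  then have "countable ((UNIV :: (int ^ 'n) set) \<times> ?I)"
    by (intro countable_SIGMA countableI_type countable_finite)
  moreover have "negligible (?N i)" if i_in: "i \<in> UNIV \<times> ?I" for i
  proof -
    obtain w ds es where i: "i = (w, ds, es)" "(ds, es) \<in> ?I"
      using i_in by blast
    then show ?thesis
      unfolding i prod.case by (blast intro: negligible_translation negligible_translates_Int)
  qed
  ultimately have "negligible (\<Union>(?N ` (UNIV \<times> ?I)))"
    by (intro negligible_countable_Union) auto
  then have "(\<Union>(?N ` (UNIV \<times> ?I))) \<noteq> UNIV"
    using non_negligible_UNIV by metis
  then obtain x where x: "x \<notin> (\<Union>(?N ` (UNIV \<times> ?I)))" by blast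
  have "ds = es" if "ds \<in> digit_lists D k" "es \<in> digit_lists D k"
    "x + of_int_vec w \<in> translate ds \<inter> translate es" for w ds es
  proof (rule ccontr)
    assume "ds \<noteq> es"
    then have "(w, ds, es) \<in> UNIV \<times> ?I" using that by blast
    moreover have "x \<in> ?N (w, ds, es)"
      unfolding prod.case using that(3) by (rule rev_image_eqI) simp
    ultimately show False using x by blast
  qed
  then show ?thesis by blast
qed

lemma exists_close_lattice_point:
  fixes x z :: "real ^ 'n"
  shows "\<exists>p. norm (x + of_int_vec p - z) \<le> real CARD('n)"
proof
  \<comment> \<open>Rounding down leaves an error of at most 1 in each coordinate.\<close>
  let ?p = "\<chi> i. \<lfloor>z $ i - x $ i\<rfloor>"
  have "norm (x + of_int_vec ?p - z) \<le> (\<Sum>i\<in>UNIV. \<bar>(x + of_int_vec ?p - z) $ i\<bar>)"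
    by (rule norm_le_l1_cart)
  also have "\<dots> \<le> (\<Sum>i\<in>(UNIV :: 'n set). 1)"
  proof (rule sum_mono)
    fix i
    have "(x + of_int_vec ?p - z) $ i = real_of_int \<lfloor>z $ i - x $ i\<rfloor> - (z $ i - x $ i)"
      by (simp add: of_int_vec_def)
    then show "\<bar>(x + of_int_vec ?p - z) $ i\<bar> \<le> 1" by linarith
  qed
  finally show "norm (x + of_int_vec ?p - z) \<le> real CARD('n)" by simp
qed

text \<open>After a lattice shift \<open>p\<close>, all points \<open>x + y + p\<close> with
  \<open>y\<close> in \<open>F\<close> fall into one ball covered by the translates. Genericity
  makes the covering string of each point unique, and its head is the digit of
  \<open>y\<close>.\<close>

lemma tiles_finite_set:
  assumes "finite F"
  shows "\<exists>L. \<forall>y\<in>F. \<exists>!d. d \<in> D \<and> y - d \<in> L"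
proof -
  \<comment> \<open>The sum dominates the norm of each \<open>y\<close> in \<open>F\<close>,
    \<open>CARD('n)\<close> absorbs the rounding error of \<open>p\<close>, and 1 makes the
    inequality strict.\<close>
  define R where "R = (\<Sum>y\<in>F. norm (of_int_vec y :: real ^ 'n)) + CARD('n) + 1"
  obtain k z where ball: "ball z R \<subseteq> (f ^^ Suc k) ` K"
    using funpow_image_K_contains_ball by blast
  obtain x where generic: "\<And>w ds es. \<lbrakk>ds \<in> digit_lists D (Suc k); es \<in> digit_lists D (Suc k);
      x + of_int_vec w \<in> translate ds \<inter> translate es\<rbrakk> \<Longrightarrow> ds = es"
    using exists_generic_point[of "Suc k"] by blast
  obtain p where p: "norm (x + of_int_vec p - z) \<le> real CARD('n)"
    using exists_close_lattice_point by blast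
  \<comment> \<open>What remains of a point once its units digit is removed and the shift by
    \<open>p\<close> is undone.\<close>
  define L where "L = {A *v digits_value A es + w - p | es w.
    es \<in> digit_lists D k \<and> x + of_int_vec w \<in> K}"
  have L_imp: "\<exists>es\<in>digit_lists D k. x + of_int_vec (y + p) \<in> translate (d # es)"
    if yd: "y - d \<in> L" for y d
  proof -
    obtain es w where es: "es \<in> digit_lists D k" "x + of_int_vec w \<in> K"
      and "y - d = A *v digits_value A es + w - p"
      using yd unfolding L_def by blast
    then have "y + p = digits_value A (d # es) + w"
      by (simp add: algebra_simps)
    then have "x + of_int_vec (y + p) = of_int_vec (digits_value A (d # es)) + (x + of_int_vec w)"
      by (simp only: of_int_vec_add ac_simps)
    then show ?thesis using es by blast
  qed
  have "\<exists>!d. d \<in> D \<and> y - d \<in> L" if "y \<in> F" for y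
  proof -
    have "norm (of_int_vec y :: real ^ 'n) \<le> (\<Sum>y\<in>F. norm (of_int_vec y :: real ^ 'n))"
      using that \<open>finite F\<close> by (intro member_le_sum) auto
    moreover have "x + of_int_vec (y + p) - z = of_int_vec y + (x + of_int_vec p - z)"
      by (simp add: of_int_vec_add)
    then have "norm (x + of_int_vec (y + p) - z) \<le> norm (of_int_vec y :: real ^ 'n) + norm (x + of_int_vec p - z)"
      by (simp only: norm_triangle_ineq)
    ultimately have "x + of_int_vec (y + p) \<in> ball z R"
      using p by (simp add: R_def dist_norm norm_minus_commute)
    then have "x + of_int_vec (y + p) \<in> (\<Union>ds\<in>digit_lists D (Suc k). translate ds)"
      using ball by (simp only: funpow_image_K subset_iff)
    then obtain d es t where d: "d \<in> D" "es \<in> digit_lists D k" and "t \<in> K"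
      and t: "x + of_int_vec (y + p) = of_int_vec (digits_value A (d # es)) + t"
      unfolding digit_lists_Suc by blast
    let ?w = "y + p - digits_value A (d # es)"
    have "x + of_int_vec ?w = t"
      unfolding of_int_vec_diff using t by (simp add: algebra_simps)
    moreover have "y - d = A *v digits_value A es + ?w - p"
      by simp
    ultimately have "y - d \<in> L"
      using d(2) \<open>t \<in> K\<close> unfolding L_def by blast
    moreover have "d' = d" if d': "d' \<in> D" "y - d' \<in> L" for d'
    proof -
      obtain es' where es': "es' \<in> digit_lists D k" "x + of_int_vec (y + p) \<in> translate (d' # es')"
        using L_imp[OF d'(2)] by blast
      \<comment> \<open>Both translates contain the same shifted generic point, so the strings
        agree, and with them their heads.\<close>
      have "d' # es' = d # es"
      proof (rule generic)
        show "x + of_int_vec (y + p) \<in> translate (d' # es') \<inter> translate (d # es)"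
          using es'(2) t \<open>t \<in> K\<close> by blast
      qed (use d d' es' in \<open>auto simp: digit_lists_def\<close>)
      then show ?thesis by simp
    qed
    ultimately show ?thesis using d(1) by blast
  qed
  then show ?thesis by (intro exI[of _ L] ballI)
qed

end

section \<open>Application to the closure of the set of digit expansions\<close>

theorem theorem1p2:
  fixes A :: "int ^ 's ^ 's" and D :: "(int ^ 's) set"
  assumes "expanding A"
    and "tile_digit_set A D"
  shows "integer_tile D"
proof -
  let ?T = "self_affine_set A D"
  have D: "finite D" "int (card D) = \<bar>det A\<bar>" "interior ?T \<noteq> {}"
    using assms(2) by (simp_all add: tile_digit_set_def)
  have bounded: "bounded ?T"
    using assms(1) D(1) by (rule bounded_self_affine_set)
  have closure_Union: "closure (\<Union>d\<in>E. (+) (of_int_vec d) ` ?T) = (\<Union>d\<in>E. (+) (of_int_vec d) ` closure ?T)"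
    if "finite E" for E :: "(int ^ 's) set"
    using that by (induction E) (simp_all add: closure_translation)
  \<comment> \<open>Passing to the closure saves proving that the set of digit expansions is closed.\<close>
  interpret self_affine_region A D "closure ?T"
  proof
    show "compact (closure ?T)" using bounded by simp
    show "interior (closure ?T) \<noteq> {}"
      using D(3) interior_mono[OF closure_subset] by blast
    \<comment> \<open>Closure commutes with the linear image because \<open>?T\<close> is bounded,
      and with the union because \<open>D\<close> is finite.\<close>
    show "(*v) (map_matrix of_int A) ` closure ?T = (\<Union>d\<in>D. (+) (of_int_vec d) ` closure ?T)"
      by (simp only: closure_bounded_linear_image[OF matrix_vector_mul_linear bounded]
          self_affine_set_image[OF assms(1)] closure_Union[OF D(1)])
  qed (use assms(1) D in auto)
  show ?thesis
    using D(1) tiling_complement_compactness[OF D(1) tiles_finite_set] by (simp add: integer_tile_def)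
qed

end
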